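(* Let $n\geq 1$ and let $w\in F_n$ be a non-empty cyclically reduced word. The cyclic presentation $P_n(w)$ is non-orientable if and only if $n$ is even and $w$ has a cyclic permutation that is equal to $u\,\theta^{n/2}(u)^{-1}$ for some reduced word $u\in F_n$, in which case $P_{n,n/2}(w)$ is a concise refinement of $P_n(w)$.
   Context: $F_n$ is the free group with basis $x_0,\ldots,x_{n-1}$; subscripts are taken modulo $n$; $\theta:F_n\to F_n$ is the automorphism $\theta(x_i)=x_{i+1}$. $P_n(w)=\langle x_0,\ldots,x_{n-1}\mid w,\theta(w),\ldots,\theta^{n-1}(w)\rangle$ and, for $1\leq t\leq n$, $P_{n,t}(w)=\langle x_0,\ldots,x_{n-1}\mid w,\theta(w),\ldots,\theta^{t-1}(w)\rangle$. $P_n(w)$ is orientable if $w$ is not a cyclic permutation of the inverse of any of its shifts $\theta^i(w)$, $0\leq i<n$, and non-orientable otherwise. In a presentation $\langle X\mid R\rangle$ with cyclically reduced relators, a relator $r\in R$ is freely redundant if it is freely trivial or if there is another $s\in R$ such that $r$ is a cyclic permutation of $s$ or of $s^{-1}$. A presentation is concise if it has no freely redundant relator. A presentation $P'$ obtained from $P$ by (successively) removing freely redundant relators is a refinement of $P$; it is a concise refinement if in addition it is concise. *)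

theory Defs
  imports "HOL-Library.Multiset" "HOL-Algebra.Group"
begin

section \<open>Words and free groups\<close>

text \<open>The letter \<open>(x, True)\<close> is the generator \<open>x\<close>, and \<open>(x, False)\<close> is its formal inverse.\<close>

type_synonym 'a word = "('a \<times> bool) list"

definition inv_letter :: "'a \<times> bool \<Rightarrow> 'a \<times> bool" where
  "inv_letter a = (fst a, \<not> snd a)"

definition inv_word :: "'a word \<Rightarrow> 'a word" where
  "inv_word w = rev (map inv_letter w)"

definition reduced :: "'a word \<Rightarrow> bool" where
  "reduced w \<longleftrightarrow> successively (\<lambda>a b. b \<noteq> inv_letter a) w"

definition cyclically_reduced :: "'a word \<Rightarrow> bool" where
  "cyclically_reduced w \<longleftrightarrow> reduced w \<and> (w \<noteq> [] \<longrightarrow> last w \<noteq> inv_letter (hd w))"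

definition cyclic_permutation :: "'a word \<Rightarrow> 'a word \<Rightarrow> bool" where
  "cyclic_permutation v w \<longleftrightarrow> (\<exists>k. v = rotate k w)"

fun push :: "'a \<times> bool \<Rightarrow> 'a word \<Rightarrow> 'a word" where
  "push a [] = [a]"
| "push a (b # w) = (if b = inv_letter a then w else a # b # w)"

definition reduce :: "'a word \<Rightarrow> 'a word" where
  "reduce w = foldr push w []"

text \<open>Elements of the free group are represented by reduced words. The product is
  concatenation followed by free reduction.\<close>

definition free_group :: "'a set \<Rightarrow> 'a word monoid" where
  "free_group X = \<lparr>carrier = {w. reduced w \<and> fst ` set w \<subseteq> X},
     mult = (\<lambda>u v. reduce (u @ v)), one = []\<rparr>"

lemma inv_letter_inv_letter [simp]: "inv_letter (inv_letter a) = a"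
  by (simp add: inv_letter_def)

lemma fst_inv_letter [simp]: "fst (inv_letter a) = fst a"
  by (simp add: inv_letter_def)

lemma inv_letter_eq_iff: "inv_letter a = b \<longleftrightarrow> a = inv_letter b"
  by (metis inv_letter_inv_letter)

lemma inv_word_inv_word [simp]: "inv_word (inv_word w) = w"
  by (simp add: inv_word_def rev_map o_def)

lemma reduced_Nil [simp]: "reduced []"
  by (simp add: reduced_def)

lemma reduced_inv_word: "reduced w \<Longrightarrow> reduced (inv_word w)"
  by (auto simp: reduced_def inv_word_def successively_map inv_letter_eq_iff
      elim!: successively_mono)

lemma reduced_push: "reduced w \<Longrightarrow> reduced (push a w)"
  by (cases w) (auto simp: reduced_def successively_Cons)

lemma push_push_inv: "reduced w \<Longrightarrow> push a (push (inv_letter a) w) = w"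
  by (cases w; cases "tl w") (auto simp: reduced_def)

lemma reduced_foldr_push: "reduced v \<Longrightarrow> reduced (foldr push u v)"
  by (induction u) (auto intro: reduced_push)

lemma reduced_reduce: "reduced (reduce w)"
  by (simp add: reduce_def reduced_foldr_push)

lemma reduce_reduced: "reduced w \<Longrightarrow> reduce w = w"
proof (induction w)
  case (Cons a w)
  then show ?case
    by (cases w) (auto simp: reduce_def reduced_def)
qed (simp add: reduce_def)

lemma foldr_push_push:
  "reduced v \<Longrightarrow> foldr push (push a u) v = push a (foldr push u v)"
  by (cases u) (auto simp: push_push_inv reduced_foldr_push)

lemma foldr_push_reduce:
  assumes "reduced v" shows "foldr push (reduce u) v = foldr push u v"
  using assms by (induction u) (auto simp: reduce_def foldr_push_push)

lemma reduce_append: "reduce (u @ v) = foldr push u (reduce v)"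
  by (simp add: reduce_def)

lemma foldr_push_inv_word: "reduced z \<Longrightarrow> foldr push (inv_word w) (foldr push w z) = z"
proof (induction w)
  case (Cons a w)
  then show ?case
    using push_push_inv[of "foldr push w z" "inv_letter a"]
    by (simp add: inv_word_def reduced_foldr_push)
qed (simp add: inv_word_def)

lemma set_push: "set (push a w) \<subseteq> insert a (set w)"
  by (cases w) auto

lemma set_reduce: "set (reduce w) \<subseteq> set w"
proof (induction w)
  case (Cons a w)
  then show ?case
    using set_push[of a "reduce w"] by (auto simp: reduce_def)
qed (simp add: reduce_def)

lemma reduce_inv_word_append: "reduce (inv_word w @ w) = []"
  using foldr_push_inv_word[of "[]" w] by (simp add: reduce_def)

lemma reduce_assoc: "reduce (reduce (u @ v) @ w) = reduce (u @ reduce (v @ w))"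
proof -
  have "reduce (reduce (u @ v) @ w) = foldr push (u @ v) (reduce w)"
    by (simp only: reduce_append[of "reduce (u @ v)"] foldr_push_reduce reduced_reduce)
  also have "\<dots> = reduce (u @ reduce (v @ w))"
    by (simp only: reduce_append[of u] reduce_reduced reduced_reduce)
       (simp add: reduce_append)
  finally show ?thesis .
qed

lemma group_free_group: "group (free_group X)"
proof (rule groupI)
  fix u v w
  assume "u \<in> carrier (free_group X)" "v \<in> carrier (free_group X)" "w \<in> carrier (free_group X)"
  then show "u \<otimes>\<^bsub>free_group X\<^esub> v \<otimes>\<^bsub>free_group X\<^esub> w
      = u \<otimes>\<^bsub>free_group X\<^esub> (v \<otimes>\<^bsub>free_group X\<^esub> w)"
    by (simp add: free_group_def reduce_assoc)
next
  fix u v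
  assume "u \<in> carrier (free_group X)" "v \<in> carrier (free_group X)"
  then show "u \<otimes>\<^bsub>free_group X\<^esub> v \<in> carrier (free_group X)"
    using set_reduce[of "u @ v"] by (auto simp: free_group_def reduced_reduce image_subset_iff)
next
  fix u assume u: "u \<in> carrier (free_group X)"
  then have "inv_word u \<in> carrier (free_group X)"
    using reduced_inv_word[of u] by (auto simp: free_group_def inv_word_def)
  then show "\<exists>v\<in>carrier (free_group X). v \<otimes>\<^bsub>free_group X\<^esub> u = \<one>\<^bsub>free_group X\<^esub>"
    by (intro bexI[of _ "inv_word u"]) (simp_all add: free_group_def reduce_inv_word_append)
qed (auto simp: free_group_def reduce_reduced)

lemma inv_free_group:
  assumes "w \<in> carrier (free_group X)"
  shows "inv\<^bsub>free_group X\<^esub> w = inv_word w"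
proof -
  interpret group "free_group X" by (rule group_free_group)
  have "inv_word w \<in> carrier (free_group X)"
    using assms reduced_inv_word[of w] by (auto simp: free_group_def inv_word_def)
  then show ?thesis
    using assms inv_equality[of "inv_word w" w]
    by (simp add: free_group_def reduce_inv_word_append)
qed


section \<open>Group presentations\<close>

text \<open>A presentation consists of a set of generators and a multiset of relators. Using a
  multiset means that two equal entries in a list of relators count as distinct relators, so
  each of them is freely redundant.\<close>

type_synonym 'a presentation = "'a set \<times> 'a word multiset"

definition freely_redundant :: "'a presentation \<Rightarrow> 'a word \<Rightarrow> bool" where
  "freely_redundant P r \<longleftrightarrow> r \<in># snd P \<and>
     (reduce r = [] \<or>
      (\<exists>s \<in># snd P - {#r#}. cyclic_permutation r s \<or> cyclic_permutation r (inv_word s)))"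

definition concise :: "'a presentation \<Rightarrow> bool" where
  "concise P \<longleftrightarrow> \<not> (\<exists>r. freely_redundant P r)"

definition remove_redundant :: "'a presentation \<Rightarrow> 'a presentation \<Rightarrow> bool" where
  "remove_redundant P P' \<longleftrightarrow>
     (\<exists>r. freely_redundant P r \<and> P' = (fst P, snd P - {#r#}))"

text \<open>\<open>refinement P P'\<close> says that \<open>P'\<close> is a refinement of \<open>P\<close>. Redundancy is tested afresh
  at each removal, with respect to the relators that are still present.\<close>

definition refinement :: "'a presentation \<Rightarrow> 'a presentation \<Rightarrow> bool" where
  "refinement = remove_redundant\<^sup>*\<^sup>*"

definition concise_refinement :: "'a presentation \<Rightarrow> 'a presentation \<Rightarrow> bool" where
  "concise_refinement P P' \<longleftrightarrow> refinement P P' \<and> concise P'"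


section \<open>Cyclic presentations\<close>

abbreviation F :: "nat \<Rightarrow> nat word monoid" where
  "F n \<equiv> free_group {..<n}"

definition theta :: "nat \<Rightarrow> nat word \<Rightarrow> nat word" where
  "theta n w = map (\<lambda>(i, e). ((i + 1) mod n, e)) w"

definition truncated_cyclic_presentation :: "nat \<Rightarrow> nat \<Rightarrow> nat word \<Rightarrow> nat presentation" where
  "truncated_cyclic_presentation n t w = ({..<n}, mset (map (\<lambda>i. (theta n ^^ i) w) [0..<t]))"

definition cyclic_presentation :: "nat \<Rightarrow> nat word \<Rightarrow> nat presentation" where
  "cyclic_presentation n w = truncated_cyclic_presentation n n w"

text \<open>Orientability of \<open>cyclic_presentation n w\<close>, as a property of the pair \<open>(n, w)\<close>.\<close>

definition orientable :: "nat \<Rightarrow> nat word \<Rightarrow> bool" where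
  "orientable n w \<longleftrightarrow> \<not> (\<exists>i<n. cyclic_permutation w (inv_word ((theta n ^^ i) w)))"

lemma theta_generator: "i < n \<Longrightarrow> theta n [(i, True)] = [((i + 1) mod n, True)]"
  by (simp add: theta_def)

lemma mod_Suc_inj:
  fixes i j n :: nat
  assumes "Suc i mod n = Suc j mod n" "i < n" "j < n"
  shows "i = j"
  using assms by (auto simp: mod_Suc split: if_splits)

lemma push_theta:
  assumes "fst a < n" "fst ` set w \<subseteq> {..<n}"
  shows "theta n (push a w) = push (case a of (i, e) \<Rightarrow> ((i + 1) mod n, e)) (theta n w)"
  using assms
  by (cases w) (auto simp: theta_def inv_letter_def split: prod.splits dest: mod_Suc_inj)

lemma theta_reduce:
  assumes "fst ` set w \<subseteq> {..<n}"
  shows "theta n (reduce w) = reduce (theta n w)"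
  using assms
proof (induction w)
  case (Cons a w)
  have "fst ` set (reduce w) \<subseteq> {..<n}"
    using Cons.prems set_reduce[of w] by auto
  then show ?case
    using Cons push_theta[of a n "reduce w"] by (simp add: reduce_def theta_def)
qed (simp add: reduce_def theta_def)

lemma theta_closed:
  assumes "w \<in> carrier (F n)" shows "theta n w \<in> carrier (F n)"
proof -
  have "theta n w = reduce (theta n w)"
    using assms theta_reduce[of w n] by (simp add: free_group_def reduce_reduced)
  then have "reduced (theta n w)"
    by (metis reduced_reduce)
  moreover have "fst ` set (theta n w) \<subseteq> {..<n}"
    using assms by (force simp: free_group_def theta_def)
  ultimately show ?thesis by (simp add: free_group_def)
qed

lemma funpow_theta_closed: "w \<in> carrier (F n) \<Longrightarrow> (theta n ^^ k) w \<in> carrier (F n)"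
  by (induction k) (auto intro: theta_closed)

lemma funpow_theta:
  assumes "fst ` set w \<subseteq> {..<n}"
  shows "(theta n ^^ k) w = map (\<lambda>(i, e). ((i + k) mod n, e)) w"
proof (induction k)
  case 0
  then show ?case using assms by (auto intro!: map_idI[symmetric])
next
  case (Suc k)
  then show ?case by (auto simp: theta_def mod_Suc_eq)
qed

lemma funpow_theta_self:
  assumes "fst ` set w \<subseteq> {..<n}" shows "(theta n ^^ n) w = w"
  using assms by (auto simp: funpow_theta intro!: map_idI)

lemma theta_iso: "theta n \<in> iso (F n) (F n)"
proof (rule isoI)
  show "theta n \<in> hom (F n) (F n)"
  proof (rule homI)
    fix u v assume "u \<in> carrier (F n)" "v \<in> carrier (F n)"
    then have "theta n (reduce (u @ v)) = reduce (theta n (u @ v))"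
      by (intro theta_reduce) (auto simp: free_group_def)
    then show "theta n (u \<otimes>\<^bsub>F n\<^esub> v) = theta n u \<otimes>\<^bsub>F n\<^esub> theta n v"
      by (simp add: free_group_def theta_def)
  qed (rule theta_closed)
  have inverse: "(theta n ^^ (n - 1)) (theta n w) = w" "theta n ((theta n ^^ (n - 1)) w) = w"
    if "w \<in> carrier (F n)" for w
  proof -
    have "(theta n ^^ n) w = w"
      using that by (intro funpow_theta_self) (simp add: free_group_def)
    moreover have "n = 0 \<Longrightarrow> w = []"
      using that by (simp add: free_group_def)
    ultimately show "(theta n ^^ (n - 1)) (theta n w) = w" "theta n ((theta n ^^ (n - 1)) w) = w"
      by (cases n; simp add: funpow_swap1; simp add: theta_def)+
  qed
  show "bij_betw (theta n) (carrier (F n)) (carrier (F n))"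
    by (rule bij_betw_byWitness[where f' = "theta n ^^ (n - 1)"])
       (auto simp: inverse simp del: One_nat_def intro: theta_closed funpow_theta_closed)
qed

end

(* If w is a rotation of the inverse of theta^k(w), applying this relation twice cancels the
   rotations, since inversion reverses their direction; hence theta^(2k)(w) = w and n divides 2k.
   The relation is a reflection of the cyclic word. A reflection cannot fix a position, since it
   flips the signs of the letters, so the axis passes between two letters and cutting there
   writes a rotation of w as u theta^k(u)^(-1). For k = 0 this would not be reduced, so k = n/2.
   The divisibility n | 2k also shows that the relators theta^i(w), i < n/2, are pairwise
   inequivalent. *)

theory Submission
  imports Defs
begin

section \<open>Cyclic permutations\<close>

lemma cyclic_permutation_sym:
  assumes "cyclic_permutation v w" shows "cyclic_permutation w v"
proof (cases "w = []")
  case True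
  with assms show ?thesis by (simp add: cyclic_permutation_def)
next
  case False
  from assms obtain k where k: "v = rotate k w" by (auto simp: cyclic_permutation_def)
  have "(length w - k mod length w + k) mod length w = 0"
    using False by (metis add_diff_inverse_nat length_greater_0_conv
        mod_add_right_eq mod_less_divisor mod_self not_less_iff_gr_or_eq add.commute)
  then have "w = rotate (length w - k mod length w) v"
    unfolding k rotate_rotate by (simp add: rotate_id)
  then show ?thesis unfolding cyclic_permutation_def by blast
qed

lemma cyclic_permutation_trans:
  "cyclic_permutation u v \<Longrightarrow> cyclic_permutation v w \<Longrightarrow> cyclic_permutation u w"
  by (auto simp: cyclic_permutation_def rotate_rotate)

lemma inv_word_append: "inv_word (u @ v) = inv_word v @ inv_word u"
  by (simp add: inv_word_def)

lemma length_inv_word [simp]: "length (inv_word w) = length w"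
  by (simp add: inv_word_def)

text \<open>Inversion reverses the direction of rotation, so the outer rotation undoes the inner
  one.\<close>

lemma rotate_inv_word_rotate: "rotate k (inv_word (rotate k w)) = inv_word w"
proof (induction k)
  case (Suc k)
  have "rotate1 (inv_word (rotate1 v)) = inv_word v" for v :: "'a word"
    by (cases v) (simp_all add: inv_word_def)
  then have "rotate k (rotate1 (inv_word (rotate1 (rotate k w)))) = inv_word w"
    using Suc by simp
  then show ?case by (simp only: rotate_Suc rotate1_rotate_swap)
qed simp

lemma cyclic_permutation_inv_word:
  assumes "cyclic_permutation v w"
  shows "cyclic_permutation (inv_word v) (inv_word w)"
  using assms rotate_inv_word_rotate
  by (metis cyclic_permutation_def cyclic_permutation_sym)

text \<open>Cyclic reducedness survives \<open>rotate1\<close>, since the new junction is the old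
  pair of last and first letter.\<close>

lemma reduced_rotate:
  assumes "cyclically_reduced w" shows "reduced (rotate k w)"
proof -
  have "cyclically_reduced (rotate1 v)" if "cyclically_reduced v" for v :: "'a word"
    using that
    by (cases v) (auto simp: cyclically_reduced_def reduced_def successively_append_iff
        successively_Cons hd_append split: if_splits)
  then have "cyclically_reduced (rotate k w)"
    using assms by (induction k) auto
  then show ?thesis by (simp add: cyclically_reduced_def)
qed

lemma not_reduced_append_inv_word:
  assumes "u \<noteq> []" shows "\<not> reduced (u @ inv_word u)"
  using assms
  by (simp add: reduced_def successively_append_iff inv_word_def hd_rev last_map)

section \<open>Powers of the shift\<close>

lemma funpow_theta_append:
  "(theta n ^^ k) (u @ v) = (theta n ^^ k) u @ (theta n ^^ k) v"
  by (induction k) (simp_all add: theta_def)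

lemma length_funpow_theta [simp]: "length ((theta n ^^ k) w) = length w"
  by (induction k) (simp_all add: theta_def)

lemma funpow_theta_inv_word: "(theta n ^^ k) (inv_word w) = inv_word ((theta n ^^ k) w)"
proof (induction k)
  case (Suc k)
  have "theta n (inv_word v) = inv_word (theta n v)" for v
    by (auto simp: theta_def inv_word_def inv_letter_def rev_map)
  with Suc show ?case by simp
qed simp

lemma funpow_theta_rotate: "(theta n ^^ k) (rotate c w) = rotate c ((theta n ^^ k) w)"
  by (induction k) (simp_all add: theta_def rotate_map)

text \<open>Signs are kept by shifts but flipped by inversion, which is what excludes reflections
  fixing a position.\<close>

lemma snd_funpow_theta: "map snd ((theta n ^^ k) w) = map snd w"
proof (induction k)
  case (Suc k)
  have "map snd (theta n v) = map snd v" for v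
    by (auto simp: theta_def)
  with Suc show ?case by simp
qed simp

lemma cyclic_permutation_funpow_theta:
  "cyclic_permutation v w \<Longrightarrow> cyclic_permutation ((theta n ^^ k) v) ((theta n ^^ k) w)"
  by (auto simp: cyclic_permutation_def funpow_theta_rotate)

text \<open>The first letter decides: its index \<open>i\<close> has to agree with
  \<open>i + k\<close> modulo \<open>n\<close>.\<close>

lemma funpow_theta_eq_self_dvd:
  assumes "fst ` set w \<subseteq> {..<n}" "w \<noteq> []" "(theta n ^^ k) w = w"
  shows "n dvd k"
proof -
  obtain i e v where w: "w = (i, e) # v" using assms(2) by (metis list.exhaust surj_pair)
  have "i < n" "(i + k) mod n = i"
    using assms(1,3) unfolding w funpow_theta[OF assms(1)[unfolded w]] by auto
  then have "n dvd (i + k) - i"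
    by (metis dvd_minus_mod)
  then show ?thesis by simp
qed

text \<open>At the junction the last letter of \<open>u\<close> meets the inverse of its own shift.
  They cancel only if the shift fixes an index, which would force \<open>n\<close> to divide
  \<open>h\<close>.\<close>

lemma reduced_append_inv_word_theta:
  assumes "u \<in> carrier (F n)" "0 < h" "h < n"
  shows "reduced (u @ inv_word ((theta n ^^ h) u))"
proof (cases "u = []")
  case True
  then show ?thesis by (simp add: funpow_theta inv_word_def)
next
  case False
  have u: "reduced u" "fst ` set u \<subseteq> {..<n}"
    using assms(1) by (auto simp: free_group_def)
  have red: "reduced (inv_word ((theta n ^^ h) u))"
    using funpow_theta_closed[OF assms(1)] by (intro reduced_inv_word) (simp add: free_group_def)
  have nonempty: "(theta n ^^ h) u \<noteq> []"
    using False by (metis length_0_conv length_funpow_theta)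
  have i: "fst (last u) < n" using u(2) last_in_set[OF False] by auto
  have "last ((theta n ^^ h) u) \<noteq> last u"
  proof
    assume "last ((theta n ^^ h) u) = last u"
    then have "(fst (last u) + h) mod n = fst (last u)"
      using False by (auto simp: funpow_theta[OF u(2)] last_map split: prod.splits)
    then have "n dvd h"
      by (metis diff_add_inverse dvd_minus_mod)
    with assms show False by (auto dest: dvd_imp_le)
  qed
  then have "hd (inv_word ((theta n ^^ h) u)) \<noteq> inv_letter (last u)"
    using nonempty by (metis hd_map hd_rev inv_letter_inv_letter inv_word_def last_map rev_map)
  with u(1) red show ?thesis by (simp add: reduced_def successively_append_iff)
qed

section \<open>Words equivalent to the inverse of a shift\<close>

lemma cyclic_permutation_inv_theta_dvd:
  assumes "fst ` set w \<subseteq> {..<n}" "w \<noteq> []"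
    and "cyclic_permutation w (inv_word ((theta n ^^ k) w))"
  shows "n dvd 2 * k"
proof -
  from assms(3) obtain c where c: "w = rotate c (inv_word ((theta n ^^ k) w))"
    by (auto simp: cyclic_permutation_def)
  \<comment> \<open>The relation is substituted into itself. The shift passes through rotation and
    inversion, so the two shifts add up.\<close>
  have "inv_word ((theta n ^^ k) w)
      = inv_word (rotate c (inv_word ((theta n ^^ (k + k)) w)))"
    by (subst c) (simp add: funpow_theta_rotate funpow_theta_inv_word funpow_add)
  then have "w = rotate c (inv_word (rotate c (inv_word ((theta n ^^ (k + k)) w))))"
    using c by simp
  then have "(theta n ^^ (k + k)) w = w"
    by (simp add: rotate_inv_word_rotate)
  then show ?thesis
    using funpow_theta_eq_self_dvd[OF assms(1,2)] by (simp add: mult_2)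
qed

text \<open>This excludes a reflection fixing a position: both sides end in a letter made from
  \<open>hd v\<close>, but with opposite signs.\<close>

lemma rotate1_neq_inv_theta:
  assumes "v \<noteq> []" shows "rotate1 v \<noteq> inv_word ((theta n ^^ k) v)"
proof
  assume eq: "rotate1 v = inv_word ((theta n ^^ k) v)"
  have nonempty: "(theta n ^^ k) v \<noteq> []"
    using assms by (metis length_0_conv length_funpow_theta)
  have "hd v = last (rotate1 v)" using assms by (cases v) auto
  also have "\<dots> = inv_letter (hd ((theta n ^^ k) v))"
    using nonempty by (simp add: eq inv_word_def last_rev hd_map)
  finally have "snd (hd v) \<noteq> snd (hd ((theta n ^^ k) v))"
    by (simp add: inv_letter_def)
  then show False
    using snd_funpow_theta[where n = n and k = k and w = v] assms nonempty by (metis hd_map)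
qed

text \<open>Moving the cut preserves the parity of the offset \<open>c\<close>. An odd offset would
  lead to offset 1, which is impossible; an even one leads to offset 0, where the word equals its
  inverted shift and splits in the middle.\<close>

lemma cyclic_permutation_inv_theta_split:
  assumes "w \<noteq> []" "cyclic_permutation w (inv_word ((theta n ^^ k) w))"
  obtains v u where "cyclic_permutation v w" "v = u @ inv_word ((theta n ^^ k) u)"
proof -
  let ?L = "length w"
  from cyclic_permutation_sym[OF assms(2)] obtain c
    where c: "inv_word ((theta n ^^ k) w) = rotate c w"
    by (auto simp: cyclic_permutation_def)
  \<comment> \<open>Moving the cut by \<open>a\<close> lowers the offset by \<open>2 * a\<close>.
    The offset \<open>c + ?L\<close> is the same rotation as \<open>c\<close> after a full
    turn.\<close>
  have reflect: "inv_word ((theta n ^^ k) (rotate a w)) = rotate b (rotate a w)"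
    if "2 * a + b = c \<or> 2 * a + b = c + ?L" for a b
  proof -
    have "rotate (c + ?L) w = rotate c w"
      by (metis mod_add_self2 rotate_conv_mod)
    moreover have "2 * a + b = a + (b + a)" by simp
    ultimately have "rotate c w = rotate (a + (b + a)) w"
      using that by metis
    then have "rotate a (inv_word ((theta n ^^ k) (rotate a w))) = rotate a (rotate b (rotate a w))"
      by (simp add: funpow_theta_rotate rotate_inv_word_rotate c rotate_rotate)
    moreover have "inj (rotate a)" unfolding rotate_def by (rule inj_fn[OF inj_rotate1])
    ultimately show ?thesis by (rule injD[rotated])
  qed
  \<comment> \<open>Both representatives of the offset are treated, so that \<open>c\<close> and
    \<open>c + ?L\<close> are even and hence the length is.\<close>
  have no_odd: "2 * a + 1 \<noteq> c" "2 * a + 1 \<noteq> c + ?L" for a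
    using reflect[of a 1]
      rotate1_neq_inv_theta[where n = n and k = k and v = "rotate a w"] assms(1) by auto
  have "even c" by (rule ccontr, erule oddE) (metis no_odd(1))
  moreover have "even (c + ?L)" by (rule ccontr, erule oddE) (metis no_odd(2))
  ultimately have "even ?L" by simp
  from \<open>even c\<close> obtain a where a: "c = 2 * a" by (rule evenE)
  from \<open>even ?L\<close> obtain l where l: "?L = 2 * l" by (rule evenE)
  define v where "v = rotate a w"
  define u u' where "u = take l v" and "u' = drop l v"
  have "inv_word ((theta n ^^ k) v) = v"
    using reflect[of a 0] a by (simp add: v_def)
  moreover have v: "v = u @ u'" and "length u = length u'"
    using l by (simp_all add: u_def u'_def v_def)
  \<comment> \<open>The inverted shift exchanges the two halves, and equal lengths allow comparing
    them separately.\<close>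
  ultimately have "u' = inv_word ((theta n ^^ k) u)"
    by (simp add: funpow_theta_append inv_word_append)
  moreover have "cyclic_permutation v w"
    by (auto simp: v_def cyclic_permutation_def)
  ultimately show thesis using that v by blast
qed

text \<open>The conclusion \<open>reduced v\<close> serves to identify the concatenation with the
  product in the free group.\<close>

lemma nonorientable_imp_split:
  assumes w: "w \<in> carrier (F n)" "w \<noteq> []" "cyclically_reduced w"
    and "\<not> orientable n w"
  obtains v u where "even n" "cyclic_permutation v w" "u \<in> carrier (F n)"
    "v = u @ inv_word ((theta n ^^ (n div 2)) u)" "reduced v"
proof -
  have gens: "fst ` set w \<subseteq> {..<n}" using w(1) by (simp add: free_group_def)
  from assms(4) obtain i where "i < n"
    and i: "cyclic_permutation w (inv_word ((theta n ^^ i) w))"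
    by (auto simp: orientable_def)
  obtain v u where vw: "cyclic_permutation v w" and v: "v = u @ inv_word ((theta n ^^ i) u)"
    using cyclic_permutation_inv_theta_split[OF w(2) i] .
  have "reduced v" and set_v: "set v = set w"
    using vw reduced_rotate[OF w(3)] by (auto simp: cyclic_permutation_def)
  then have "reduced u" by (simp add: v reduced_def successively_append_iff)
  moreover have "fst ` set u \<subseteq> {..<n}" using set_v gens by (auto simp: v)
  ultimately have u: "u \<in> carrier (F n)" by (simp add: free_group_def)
  have i0: "i \<noteq> 0"
  proof
    assume "i = 0"
    moreover have "u \<noteq> []" using v set_v w(2)
      by (auto simp: inv_word_def funpow_theta)
    ultimately show False
      using not_reduced_append_inv_word[of u] \<open>reduced v\<close> v by simp
  qed
  obtain q where q: "2 * i = n * q"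
    using cyclic_permutation_inv_theta_dvd[OF gens w(2) i] by (auto elim: dvdE)
  \<comment> \<open>Since \<open>0 < i\<close> and \<open>i < n\<close>, the equation
    \<open>2 * i = n * q\<close> leaves only \<open>q = 1\<close>.\<close>
  have "n * q < n * 2" using \<open>i < n\<close> by (simp flip: q)
  then have "q < 2" by (simp only: mult_less_cancel1)
  with q i0 have "q = 1" by (cases q) auto
  with q have "2 * i = n" by simp
  then have "even n" "i = n div 2" by auto
  then show thesis using that vw u v \<open>reduced v\<close> by simp
qed

text \<open>The shift by \<open>h\<close> is an involution here, so the inverted shift fixes the
  split word; rotating carries this over to \<open>w\<close>.\<close>

lemma split_imp_cyclic_permutation_inv_theta:
  assumes "fst ` set u \<subseteq> {..<n}" "n = 2 * h"
    and "cyclic_permutation (u @ inv_word ((theta n ^^ h) u)) w"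
  shows "cyclic_permutation w (inv_word ((theta n ^^ h) w))"
proof -
  define v where "v = u @ inv_word ((theta n ^^ h) u)"
  have "(theta n ^^ h) ((theta n ^^ h) u) = u"
    using funpow_theta_self[OF assms(1)] assms(2) by (metis comp_apply funpow_add mult_2)
  then have "inv_word ((theta n ^^ h) v) = v"
    by (simp add: v_def funpow_theta_append funpow_theta_inv_word inv_word_append)
  moreover have "cyclic_permutation v w" using assms(3) by (simp add: v_def)
  ultimately show ?thesis
    by (metis cyclic_permutation_funpow_theta cyclic_permutation_inv_word
        cyclic_permutation_sym cyclic_permutation_trans)
qed

section \<open>The refinement\<close>

text \<open>Relators are removed from the highest index down; \<open>t\<close> is general so that
  the downward induction from \<open>n\<close> goes through.\<close>

lemma refinement_truncated:
  assumes "n = h + h" "cyclic_permutation w (inv_word ((theta n ^^ h) w))"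
    and "fst ` set w \<subseteq> {..<n}" "h \<le> t" "t \<le> n"
  shows "refinement (cyclic_presentation n w) (truncated_cyclic_presentation n t w)"
  using assms(5,4)
proof (induction rule: inc_induct)
  case base
  show ?case by (simp add: refinement_def cyclic_presentation_def)
next
  case (step t)
  let ?P = "truncated_cyclic_presentation n"
  have "(theta n ^^ h) ((theta n ^^ h) w) = w"
    using funpow_theta_self[OF assms(3)] assms(1) by (metis comp_apply funpow_add)
  then have "cyclic_permutation ((theta n ^^ h) w) (inv_word w)"
    using cyclic_permutation_funpow_theta[OF assms(2), where k = h and n = n]
    by (simp add: funpow_theta_inv_word)
  from cyclic_permutation_funpow_theta[OF this, where k = "t - h" and n = n]
  have "cyclic_permutation ((theta n ^^ t) w) (inv_word ((theta n ^^ (t - h)) w))"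
    using step.prems
    by (simp add: funpow_theta_inv_word flip: funpow_add[THEN fun_cong, unfolded comp_apply])
  \<comment> \<open>The relator of index \<open>t - h\<close> is still present:
    \<open>h \<le> t\<close> and \<open>t < h + h\<close> give \<open>0 < h\<close>, so its index is
    below \<open>t\<close>.\<close>
  moreover have "(theta n ^^ (t - h)) w \<in># snd (?P (Suc t) w) - {#(theta n ^^ t) w#}"
    using step assms(1) by (auto simp: truncated_cyclic_presentation_def)
  ultimately have "freely_redundant (?P (Suc t) w) ((theta n ^^ t) w)"
    unfolding freely_redundant_def by (auto simp: truncated_cyclic_presentation_def)
  then have "remove_redundant (?P (Suc t) w) (?P t w)"
    unfolding remove_redundant_def
    by (intro exI[of _ "(theta n ^^ t) w"]) (simp add: truncated_cyclic_presentation_def)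
  then show ?case
    using step unfolding refinement_def by (meson Suc_leD le_SucI rtranclp.rtrancl_into_rtrancl)
qed

text \<open>Two equivalent relators with indices \<open>i\<close> and \<open>j\<close> below
  \<open>h\<close> would make \<open>i\<close> and \<open>j\<close> congruent modulo
  \<open>h\<close>, hence equal.\<close>

lemma concise_truncated:
  assumes "n = h + h" "cyclic_permutation w (inv_word ((theta n ^^ h) w))"
    and "w \<in> carrier (F n)" "w \<noteq> []"
  shows "concise (truncated_cyclic_presentation n h w)"
  unfolding concise_def
proof
  let ?M = "snd (truncated_cyclic_presentation n h w)"
  have gens: "fst ` set w \<subseteq> {..<n}" using assms(3) by (simp add: free_group_def)
  have M: "?M = image_mset (\<lambda>i. (theta n ^^ i) w) (mset_set {..<h})"
    by (simp add: truncated_cyclic_presentation_def lessThan_atLeast0 flip: mset_upt)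
  \<comment> \<open>The shift by \<open>n - i\<close>, standing for a shift by -i, brings the
    relator of index \<open>i\<close> back to \<open>w\<close>.\<close>
  have inv_dvd: "n dvd 2 * (n - i + j)"
    if "i < n" "cyclic_permutation ((theta n ^^ i) w) (inv_word ((theta n ^^ j) w))" for i j
  proof (rule cyclic_permutation_inv_theta_dvd[OF gens assms(4)])
    have "(theta n ^^ (n - i)) ((theta n ^^ i) w) = w"
      using that(1) funpow_theta_self[OF gens]
      by (simp flip: funpow_add[THEN fun_cong, unfolded comp_apply])
    then show "cyclic_permutation w (inv_word ((theta n ^^ (n - i + j)) w))"
      using cyclic_permutation_funpow_theta[OF that(2), where k = "n - i" and n = n]
      by (simp add: funpow_theta_inv_word funpow_add)
  qed
  \<comment> \<open>Trading the shift by \<open>j\<close> for the inverse of the shift by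
    \<open>j + h\<close> reduces this case to the inverted one.\<close>
  have same_dvd: "n dvd 2 * (n - i + (j + h))"
    if "i < n" "cyclic_permutation ((theta n ^^ i) w) ((theta n ^^ j) w)" for i j
    using inv_dvd[OF that(1)] that(2)
      cyclic_permutation_funpow_theta[OF assms(2), where k = j and n = n]
    by (metis comp_apply cyclic_permutation_trans funpow_add funpow_theta_inv_word)
  assume "\<exists>r. freely_redundant (truncated_cyclic_presentation n h w) r"
  then obtain r where r: "r \<in># ?M" "reduce r = [] \<or>
      (\<exists>s \<in># ?M - {#r#}. cyclic_permutation r s \<or> cyclic_permutation r (inv_word s))"
    by (auto simp: freely_redundant_def)
  from r(1) obtain i where i: "i < h" "r = (theta n ^^ i) w" by (auto simp: M)
  have "reduce r = r"
    using funpow_theta_closed[OF assms(3)] i by (simp add: free_group_def reduce_reduced)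
  moreover have "r \<noteq> []" using i assms(4) by (metis length_0_conv length_funpow_theta)
  ultimately obtain s where s: "s \<in># ?M - {#r#}"
      "cyclic_permutation r s \<or> cyclic_permutation r (inv_word s)"
    using r(2) by auto
  \<comment> \<open>The copy removed is the one of index \<open>i\<close>, so \<open>s\<close> has
    another index \<open>j\<close> even if the two words were equal.\<close>
  have "mset_set {..<h} = add_mset i (mset_set ({..<h} - {i}))"
    using i by (simp add: mset_set.remove)
  then have "?M - {#r#} = image_mset (\<lambda>i. (theta n ^^ i) w) (mset_set ({..<h} - {i}))"
    by (simp add: M i)
  with s(1) obtain j where j: "j < h" "j \<noteq> i" "s = (theta n ^^ j) w" by auto
  have "i < n" using i assms(1) by simp
  have "n dvd 2 * (n - i + (j + h)) \<or> n dvd 2 * (n - i + j)"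
    using s(2) same_dvd[OF \<open>i < n\<close>] inv_dvd[OF \<open>i < n\<close>] i j by blast
  \<comment> \<open>The two alternatives agree modulo \<open>n\<close>, because
    \<open>2 * h = n\<close>.\<close>
  moreover have "2 * (n - i + (j + h)) = 2 * (n - i + j) + n" using assms(1) by simp
  ultimately have "n dvd 2 * (n - i + j)" by (simp only: dvd_add_triv_right_iff) simp
  then have "2 * h dvd 2 * (n - i + j)" using assms(1) by (simp only: mult_2)
  then have "h dvd n - i + j" by (rule dvd_mult_cancel) simp
  moreover have "n - i + j = h + (h + j - i)" using assms(1) i by simp
  ultimately have "h dvd h + j - i" by simp
  \<comment> \<open>The only multiple of \<open>h\<close> strictly between 0 and
    \<open>2 * h\<close> is \<open>h\<close> itself, which gives \<open>j = i\<close>.\<close>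
  then obtain q where q: "h + j - i = h * q" by (auto elim: dvdE)
  moreover have "0 < h + j - i" "h + j - i < h * 2" using i j by auto
  ultimately have "0 < q" "q < 2" by (auto intro: gr0I)
  then have "h + j - i = h" using q by (simp add: less_2_cases_iff)
  then show False using i j by simp
qed

theorem theorem3p4:
  fixes n :: nat and w :: "nat word"
  assumes "n \<ge> 1"
    and "w \<in> carrier (F n)"
    and "w \<noteq> []"
    and "cyclically_reduced w"
  shows "(\<not> orientable n w \<longleftrightarrow>
           even n \<and>
           (\<exists>v u. cyclic_permutation v w \<and> u \<in> carrier (F n) \<and>
              v = u \<otimes>\<^bsub>F n\<^esub> inv\<^bsub>F n\<^esub> ((theta n ^^ (n div 2)) u)))
       \<and> (\<not> orientable n w \<longrightarrow>
           concise_refinement (cyclic_presentation n w)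
             (truncated_cyclic_presentation n (n div 2) w))"
proof (intro conjI iffI impI)
  let ?h = "n div 2"
  \<comment> \<open>The group product reduces the concatenation, so each direction has to show that
    nothing cancels.\<close>
  have prod: "u \<otimes>\<^bsub>F n\<^esub> inv\<^bsub>F n\<^esub> ((theta n ^^ ?h) u)
      = reduce (u @ inv_word ((theta n ^^ ?h) u))" if "u \<in> carrier (F n)" for u
    using funpow_theta_closed[OF that] by (simp add: inv_free_group) (simp add: free_group_def)
  {
    assume "\<not> orientable n w"
    from nonorientable_imp_split[OF assms(2-4) this]
    obtain v u where vu: "even n" "cyclic_permutation v w" "u \<in> carrier (F n)"
      "v = u @ inv_word ((theta n ^^ ?h) u)" "reduced v" .
    show "even n" by fact
    show "\<exists>v u. cyclic_permutation v w \<and> u \<in> carrier (F n) \<and>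
        v = u \<otimes>\<^bsub>F n\<^esub> inv\<^bsub>F n\<^esub> ((theta n ^^ ?h) u)"
      using vu prod reduce_reduced by metis
    have gens: "fst ` set w \<subseteq> {..<n}" "fst ` set u \<subseteq> {..<n}"
      using assms(2) vu(3) by (simp_all add: free_group_def)
    have n: "n = ?h + ?h" using vu(1) by auto
    \<comment> \<open>The relation for the shift by exactly \<open>?h\<close> is recovered from the
      split.\<close>
    have "cyclic_permutation w (inv_word ((theta n ^^ ?h) w))"
      using split_imp_cyclic_permutation_inv_theta[OF gens(2)] vu by auto
    then show "concise_refinement (cyclic_presentation n w)
        (truncated_cyclic_presentation n ?h w)"
      unfolding concise_refinement_def
      using refinement_truncated[OF n _ gens(1)] concise_truncated[OF n _ assms(2,3)] by simp
  next
    assume "even n \<and> (\<exists>v u. cyclic_permutation v w \<and> u \<in> carrier (F n) \<and>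
        v = u \<otimes>\<^bsub>F n\<^esub> inv\<^bsub>F n\<^esub> ((theta n ^^ ?h) u))"
    then obtain u where "even n" and u: "u \<in> carrier (F n)"
      and uw: "cyclic_permutation (reduce (u @ inv_word ((theta n ^^ ?h) u))) w"
      using prod by auto
    \<comment> \<open>An even \<open>n \<ge> 1\<close> is at least 2, so the shift by
      \<open>?h\<close> moves every index and \<open>?h\<close> is an admissible witness of
      non-orientability.\<close>
    have h: "0 < ?h" "?h < n" "n = 2 * ?h" using \<open>even n\<close> assms(1) by auto
    have "fst ` set u \<subseteq> {..<n}" using u by (simp add: free_group_def)
    from split_imp_cyclic_permutation_inv_theta[OF this h(3)]
    have "cyclic_permutation w (inv_word ((theta n ^^ ?h) w))"
      using uw reduced_append_inv_word_theta[OF u h(1,2)] by (simp add: reduce_reduced)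
    then show "\<not> orientable n w" using h(2) by (auto simp: orientable_def)
  }
qed

end
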